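(* Let $b\in\mathbb C$ and $g(t)=\sum_{i=1}^na_it^i\in\mathbb C[t]$, where $n\geq2$ and $a_n\neq0$. Then $$T_1(g,b)\simeq M\big(b,(1,n-1,0),K_1\big),\qquad T_2(g,b)\simeq M\big(b,(n-1,1,0),K_2\big),$$ where $K_1,K_2\in\mathrm{GL}_n(\mathbb C)$ are $$K_1:=\begin{pmatrix}-a_1&-1&0&\cdots&0\\-2a_2&0&-1&\cdots&0\\\vdots&\vdots&\ddots&\ddots&\vdots\\-(n-1)a_{n-1}&0&\cdots&0&-1\\-na_n&0&\cdots&0&0\end{pmatrix},\qquad K_2:=\begin{pmatrix}0&0&\cdots&-\tfrac{a_1}{na_n}&-\tfrac1{na_n}\\1&0&\cdots&-\tfrac{2a_2}{na_n}&0\\0&1&\ddots&\vdots&\vdots\\\vdots&\vdots&\ddots&-\tfrac{(n-1)a_{n-1}}{na_n}&0\\0&0&\cdots&1&0\end{pmatrix}.$$ (That is, $K_2\mathsf e_i=\mathsf e_{i+1}$ for $1\leq i\leq n-2$, $K_2\mathsf e_{n-1}=\mathsf e_n-\sum_{i=1}^{n-1}\tfrac{ia_i}{na_n}\mathsf e_i$, $K_2\mathsf e_n=-\tfrac1{na_n}\mathsf e_1$, with $\mathsf e_i$ the standard basis of $\mathbb C^n$.)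
   Context: The Lie algebra $\mathfrak{sl}(2)$ over $\mathbb C$ has basis $e,f,h$ with $[h,e]=e$, $[h,f]=-f$, $[e,f]=2h$; $\mathfrak h=\mathbb Ch$. The automorphism $\sigma$ of $\mathbb C[h]$ is $\sigma(g(h))=g(h-1)$, applied entrywise. For $E,F\in\mathrm{Mat}_n(\mathbb C[h])$ with $E\sigma(F)-F\sigma^{-1}(E)=2h\,\mathrm I_n$, $M(E,F)$ is the $\mathfrak{sl}(2)$-module on $\mathbb C[h]^{\oplus n}$ with $h$ acting by multiplication, $e\cdot\boldsymbol g=E\sigma(\boldsymbol g)$, $f\cdot\boldsymbol g=F\sigma^{-1}(\boldsymbol g)$. Put $\lambda_\alpha(h)=-(h-\alpha+1)(h+\alpha)$. For $\boldsymbol a=(a_-,a_0,a_+)\in\mathbb Z_{\geq0}^3$ with $a_-+a_0+a_+=n$, $P_{(\boldsymbol a,\alpha)}(h)$ is the diagonal $n\times n$ matrix with diagonal entries: $1$ ($a_-$ times), then $h-\alpha+1$ ($a_0$ times), then $(h-\alpha+1)(h+\alpha)$ ($a_+$ times); $\overline P_{(\boldsymbol a,\alpha)}(h)$ is the diagonal matrix with $\overline P_{(\boldsymbol a,\alpha)}P_{(\boldsymbol a,\alpha)}=\lambda_\alpha(h)\mathrm I_n$. For $K(h)\in\mathrm{GL}_n(\mathbb C[h])$ set $M(\alpha,\boldsymbol a,K(h)):=M\big(\sigma(K^{-1}(h)\overline P_{(\boldsymbol a,\alpha)}(h)),P_{(\boldsymbol a,\alpha)}(h)K(h)\big)$. Let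 $\mathcal D(1)$ be the algebra of polynomial differential operators on $\mathbb C[t]$, $\partial=d/dt$, acting on $\mathbb C[t]e^g$ by $\partial(pe^g)=(p'+pg')e^g$. $T_1(g,b)$ and $T_2(g,b)$ denote $\mathbb C[t]e^g$ as an $\mathfrak{sl}(2)$-module via the homomorphisms $U(\mathfrak{sl}(2))\to\mathcal D(1)$ - $\Phi_1$: $e\mapsto t^2\partial+2bt$, $f\mapsto-\partial$, $h\mapsto t\partial+b$; - $\Phi_2$: $e\mapsto-t\partial^2+(2b-2)\partial$, $f\mapsto t$, $h\mapsto-t\partial+(b-1)$, respectively. *)

theory Defs
  imports Jordan_Normal_Form.VS_Connect
begin

section \<open>The Lie algebra sl(2) and its modules\<close>

text \<open>\<open>Sl2 x y z\<close> is the element \<open>x e + y f + z h\<close> of the complex Lie algebra sl(2). The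
  bracket is the bilinear antisymmetric extension of \<open>[h,e] = e\<close>, \<open>[h,f] = -f\<close>, \<open>[e,f] = 2h\<close>
  (so \<open>h\<close> is half of the usual Cartan element).\<close>

datatype sl2 = Sl2 (e_coord: complex) (f_coord: complex) (h_coord: complex)

definition sl2_add :: "sl2 \<Rightarrow> sl2 \<Rightarrow> sl2" where
  "sl2_add X Y = Sl2 (e_coord X + e_coord Y) (f_coord X + f_coord Y) (h_coord X + h_coord Y)"

definition sl2_scale :: "complex \<Rightarrow> sl2 \<Rightarrow> sl2" where
  "sl2_scale c X = Sl2 (c * e_coord X) (c * f_coord X) (c * h_coord X)"

definition sl2_bracket :: "sl2 \<Rightarrow> sl2 \<Rightarrow> sl2" where
  "sl2_bracket X Y =
     Sl2 (h_coord X * e_coord Y - e_coord X * h_coord Y)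
         (f_coord X * h_coord Y - h_coord X * f_coord Y)
         (2 * (e_coord X * f_coord Y - f_coord X * e_coord Y))"

lemma sl2_bracket_basis:
  "sl2_bracket (Sl2 0 0 1) (Sl2 1 0 0) = Sl2 1 0 0"
  "sl2_bracket (Sl2 0 0 1) (Sl2 0 1 0) = sl2_scale (-1) (Sl2 0 1 0)"
  "sl2_bracket (Sl2 1 0 0) (Sl2 0 1 0) = sl2_scale 2 (Sl2 0 0 1)"
  by (simp_all add: sl2_bracket_def sl2_scale_def)

text \<open>A complex vector space is a \<open>module\<close> record over \<open>class_ring\<close>; its fields \<open>mult\<close> and
  \<open>one\<close> play no role, as in \<open>module_vec\<close>.\<close>

record 'v sl2_rep = "(complex, 'v) module" +
  act :: "sl2 \<Rightarrow> 'v \<Rightarrow> 'v"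

definition sl2_module :: "'v sl2_rep \<Rightarrow> bool" where
  "sl2_module V \<longleftrightarrow>
     vectorspace class_ring V \<and>
     (\<forall>X. act V X \<in> LinearCombinations.module_hom class_ring V V) \<and>
     (\<forall>X Y. \<forall>v\<in>carrier V. act V (sl2_add X Y) v = act V X v \<oplus>\<^bsub>V\<^esub> act V Y v) \<and>
     (\<forall>c X. \<forall>v\<in>carrier V. act V (sl2_scale c X) v = c \<odot>\<^bsub>V\<^esub> act V X v) \<and>
     (\<forall>X Y. \<forall>v\<in>carrier V.
        act V (sl2_bracket X Y) v = act V X (act V Y v) \<ominus>\<^bsub>V\<^esub> act V Y (act V X v))"

definition sl2_isomorphic :: "'v sl2_rep \<Rightarrow> 'w sl2_rep \<Rightarrow> bool" where
  "sl2_isomorphic V W \<longleftrightarrow>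
     sl2_module V \<and> sl2_module W \<and>
     (\<exists>\<phi>\<in>LinearCombinations.module_hom class_ring V W.
        bij_betw \<phi> (carrier V) (carrier W) \<and>
        (\<forall>X. \<forall>v\<in>carrier V. \<phi> (act V X v) = act W X (\<phi> v)))"

definition with_sl2_action ::
  "(complex, 'v) module \<Rightarrow> ('v \<Rightarrow> 'v) \<Rightarrow> ('v \<Rightarrow> 'v) \<Rightarrow> ('v \<Rightarrow> 'v) \<Rightarrow> 'v sl2_rep" where
  "with_sl2_action V e f h = module.extend V (sl2_rep.fields
     (\<lambda>X v. e_coord X \<odot>\<^bsub>V\<^esub> e v \<oplus>\<^bsub>V\<^esub> f_coord X \<odot>\<^bsub>V\<^esub> f v \<oplus>\<^bsub>V\<^esub> h_coord X \<odot>\<^bsub>V\<^esub> h v))"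

section \<open>The modules M(E, F)\<close>

text \<open>Elements of \<open>complex poly\<close> are polynomials in \<open>h\<close> here, so \<open>h\<close> itself is \<open>[:0, 1:]\<close>.\<close>

definition shift :: "complex poly \<Rightarrow> complex poly" where
  "shift g = pcompose g [:-1, 1:]"

definition shift_inv :: "complex poly \<Rightarrow> complex poly" where
  "shift_inv g = pcompose g [:1, 1:]"

lemma shift_inverse: "shift_inv (shift g) = g" "shift (shift_inv g) = g"
proof -
  have X: "pcompose g [:0, 1:] = g"
    by (induction g) (simp_all add: pcompose_pCons)
  show "shift_inv (shift g) = g" "shift (shift_inv g) = g"
    by (simp_all add: shift_def shift_inv_def pcompose_assoc [symmetric] pcompose_pCons X)
qed

text \<open>The complex vector space of column vectors of length \<open>n\<close> over \<open>\<complex>[h]\<close>.\<close>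

definition poly_vec_space :: "nat \<Rightarrow> (complex, complex poly vec) module" where
  "poly_vec_space n = \<lparr>carrier = carrier_vec n, mult = undefined, one = undefined,
     zero = 0\<^sub>v n, add = (+), smult = (\<lambda>c v. [:c:] \<cdot>\<^sub>v v)\<rparr>"

text \<open>\<open>M_mod n E F\<close> is only used for \<open>n \<times> n\<close> matrices with
  \<open>E \<sigma>(F) - F \<sigma>\<inverse>(E) = 2h I\<close>; this is exactly what makes it an sl(2)-module.\<close>

definition M_mod :: "nat \<Rightarrow> complex poly mat \<Rightarrow> complex poly mat \<Rightarrow> complex poly vec sl2_rep" where
  "M_mod n E F = with_sl2_action (poly_vec_space n)
     (\<lambda>v. E *\<^sub>v map_vec shift v)
     (\<lambda>v. F *\<^sub>v map_vec shift_inv v)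
     (\<lambda>v. [:0, 1:] \<cdot>\<^sub>v v)"

abbreviation GL :: "'a :: comm_ring_1 itself \<Rightarrow> nat \<Rightarrow> 'a mat set" where
  "GL ty n \<equiv> Units (ring_mat ty n ())"

definition GL_inv :: "nat \<Rightarrow> complex poly mat \<Rightarrow> complex poly mat" where
  "GL_inv n K = inv\<^bsub>ring_mat TYPE(complex poly) n ()\<^esub> K"

definition lam :: "complex \<Rightarrow> complex poly" where
  "lam \<alpha> = - ([:1 - \<alpha>, 1:] * [:\<alpha>, 1:])"

text \<open>The multiplicity vector \<open>(a\<^sub>-, a\<^sub>0, a\<^sub>+)\<close> is a triple of naturals.\<close>

fun size3 :: "nat \<times> nat \<times> nat \<Rightarrow> nat" where
  "size3 (am, a0, ap) = am + a0 + ap"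

fun P_entry :: "nat \<times> nat \<times> nat \<Rightarrow> complex \<Rightarrow> nat \<Rightarrow> complex poly" where
  "P_entry (am, a0, ap) \<alpha> i =
     (if i < am then 1
      else if i < am + a0 then [:1 - \<alpha>, 1:]
      else [:1 - \<alpha>, 1:] * [:\<alpha>, 1:])"

definition P_mat :: "nat \<times> nat \<times> nat \<Rightarrow> complex \<Rightarrow> complex poly mat" where
  "P_mat a \<alpha> = mat_diag (size3 a) (P_entry a \<alpha>)"

text \<open>The division is exact: see \<open>P_bar_mult\<close>.\<close>

definition P_bar :: "nat \<times> nat \<times> nat \<Rightarrow> complex \<Rightarrow> complex poly mat" where
  "P_bar a \<alpha> = mat_diag (size3 a) (\<lambda>i. lam \<alpha> div P_entry a \<alpha> i)"

lemma P_entry_dvd: "P_entry a \<alpha> i dvd lam \<alpha>"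
  by (cases a) (auto simp: lam_def simp del: mult_pCons_left mult_pCons_right)

lemma P_bar_mult: "P_bar a \<alpha> * P_mat a \<alpha> = lam \<alpha> \<cdot>\<^sub>m 1\<^sub>m (size3 a)"
  unfolding P_bar_def P_mat_def mat_diag_diag
  by (rule eq_matI) (auto simp: mat_diag_def P_entry_dvd)

definition M_alpha ::
  "complex \<Rightarrow> nat \<times> nat \<times> nat \<Rightarrow> complex poly mat \<Rightarrow> complex poly vec sl2_rep" where
  "M_alpha \<alpha> a K =
     M_mod (size3 a) (map_mat shift (GL_inv (size3 a) K * P_bar a \<alpha>)) (P_mat a \<alpha> * K)"

section \<open>The modules \<open>T\<^sub>1(g, b)\<close> and \<open>T\<^sub>2(g, b)\<close>\<close>

text \<open>Here \<open>complex poly\<close> is \<open>\<complex>[t]\<close>, and \<open>p\<close> represents the element \<open>p e\<^sup>g\<close> of \<open>\<complex>[t] e\<^sup>g\<close>;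
  \<open>del g\<close> is the action of \<open>\<partial>\<close> and \<open>mult_t\<close> that of \<open>t\<close> in this representation. The actions of
  \<open>e\<close>, \<open>f\<close>, \<open>h\<close> are those of their images in the Weyl algebra.\<close>

definition exp_poly_space :: "(complex, complex poly) module" where
  "exp_poly_space = \<lparr>carrier = UNIV, mult = undefined, one = undefined,
     zero = 0, add = (+), smult = Polynomial.smult\<rparr>"

definition del :: "complex poly \<Rightarrow> complex poly \<Rightarrow> complex poly" where
  "del g p = pderiv p + p * pderiv g"

definition mult_t :: "complex poly \<Rightarrow> complex poly" where
  "mult_t p = [:0, 1:] * p"

definition T1 :: "complex poly \<Rightarrow> complex \<Rightarrow> complex poly sl2_rep" where
  "T1 g b = with_sl2_action exp_poly_space
     (\<lambda>p. mult_t (mult_t (del g p)) + Polynomial.smult (2 * b) (mult_t p))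
     (\<lambda>p. - del g p)
     (\<lambda>p. mult_t (del g p) + Polynomial.smult b p)"

definition T2 :: "complex poly \<Rightarrow> complex \<Rightarrow> complex poly sl2_rep" where
  "T2 g b = with_sl2_action exp_poly_space
     (\<lambda>p. - mult_t (del g (del g p)) + Polynomial.smult (2 * b - 2) (del g p))
     (\<lambda>p. mult_t p)
     (\<lambda>p. - mult_t (del g p) + Polynomial.smult (b - 1) p)"

section \<open>The matrices \<open>K\<^sub>1\<close> and \<open>K\<^sub>2\<close>\<close>

text \<open>Rows and columns are indexed from \<open>0\<close>, whereas \<open>c i\<close> is the coefficient of \<open>t\<^sup>i\<close>, so row \<open>i\<close>
  involves \<open>(i + 1) c (i + 1)\<close>.\<close>

definition K1_mat :: "nat \<Rightarrow> (nat \<Rightarrow> complex) \<Rightarrow> complex mat" where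
  "K1_mat n c = mat n n (\<lambda>(i, j).
     if j = 0 then - of_nat (i + 1) * c (i + 1)
     else if j = i + 1 then - 1
     else 0)"

definition K2_mat :: "nat \<Rightarrow> (nat \<Rightarrow> complex) \<Rightarrow> complex mat" where
  "K2_mat n c = mat n n (\<lambda>(i, j).
     if j = n - 1 then (if i = 0 then - 1 / (of_nat n * c n) else 0)
     else if i = j + 1 then 1
     else if j = n - 2 then - (of_nat (i + 1) * c (i + 1)) / (of_nat n * c n)
     else 0)"

abbreviation const_mat :: "complex mat \<Rightarrow> complex poly mat" where
  "const_mat K \<equiv> map_mat (\<lambda>c. [:c:]) K"

end

theory Submission
  imports Defs
begin

text \<open>On both modules the image of \<open>h\<close> raises degrees by exactly \<open>n\<close>, so any \<open>n\<close> polynomials whose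
  degrees are \<open>0, \<dots>, n - 1\<close> in some order form a \<open>\<complex>[h]\<close>-basis. The bases adapted to the two
  presentations are \<open>g', 1, t, \<dots>, t^(n-2)\<close> for \<open>T\<^sub>1\<close> and \<open>t, t^2, \<dots>, t^(n-1), -1/(n a\<^sub>n)\<close> for \<open>T\<^sub>2\<close>:
  in them \<open>f\<close> has matrix \<open>P K\<close>. The action of \<open>e\<close> then needs no computation, because
  \<open>f e = \<lambda>\<^sub>\<alpha>(h)\<close> on both sides and \<open>f\<close> is injective on \<open>\<complex>[t]\<close>. That \<open>M(\<alpha>, a, K)\<close> is a module
  at all is inherited through the resulting bijection.\<close>

section \<open>Polynomials in a linear operator\<close>

locale poly_operator =
  fixes D :: "'a::comm_ring_1 poly \<Rightarrow> 'a poly"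
  assumes op_add: "D (p + q) = D p + D q"
    and op_smult: "D (Polynomial.smult c p) = Polynomial.smult c (D p)"
begin

lemma op_zero: "D 0 = 0"
  using op_smult[of 0 0] by simp

lemma op_uminus: "D (- p) = - D p"
  using op_smult[of "- 1" p] by simp

lemma op_diff: "D (p - q) = D p - D q"
  using op_add[of p "- q"] by (simp add: op_uminus)

lemma op_sum: "D (\<Sum>i\<in>I. p i) = (\<Sum>i\<in>I. D (p i))"
  by (induction I rule: infinite_finite_induct) (simp_all add: op_zero op_add)

end

text \<open>This is \<open>q(D) p\<close> by Horner's scheme: it makes polynomials in t a module
  over polynomials in h, with h acting as \<open>D\<close>.\<close>

definition poly_op :: "('a::comm_ring_1 poly \<Rightarrow> 'a poly) \<Rightarrow> 'a poly \<Rightarrow> 'a poly \<Rightarrow> 'a poly" where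
  "poly_op D q p = fold_coeffs (\<lambda>a r. Polynomial.smult a p + D r) q 0"

context poly_operator
begin

lemma poly_op_0: "poly_op D 0 p = 0"
  by (simp add: poly_op_def)

lemma poly_op_pCons:
  "poly_op D (pCons a q) p = Polynomial.smult a p + D (poly_op D q p)"
\<comment> \<open>\<open>pCons 0 0\<close> is the zero polynomial, so the fold makes no step there;
  the recursion still holds because \<open>D 0 = 0\<close>.\<close>
proof (cases "q = 0 \<and> a = 0")
  case True
  then show ?thesis by (simp add: poly_op_def op_zero)
next
  case False
  then show ?thesis
    by (cases "q = 0") (simp_all add: poly_op_def)
qed

lemma poly_op_const: "poly_op D [:a:] p = Polynomial.smult a p"
  by (simp add: poly_op_pCons poly_op_0 op_zero)

lemma poly_op_add: "poly_op D (q + r) p = poly_op D q p + poly_op D r p"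
  by (induction q r rule: poly_induct2)
    (simp_all add: poly_op_0 poly_op_pCons op_add smult_add_left)

lemma poly_op_smult: "poly_op D (Polynomial.smult c q) p = Polynomial.smult c (poly_op D q p)"
  by (induction q) (simp_all add: poly_op_0 poly_op_pCons op_smult smult_add_right)

lemma poly_op_sum: "poly_op D (\<Sum>i\<in>I. q i) p = (\<Sum>i\<in>I. poly_op D (q i) p)"
  by (induction I rule: infinite_finite_induct) (simp_all add: poly_op_0 poly_op_add)

lemma poly_op_mult: "poly_op D (q * r) p = poly_op D q (poly_op D r p)"
  by (induction q) (simp_all add: poly_op_0 poly_op_pCons poly_op_add poly_op_smult)

lemma poly_operator_poly_op: "poly_operator (poly_op D q)"
proof
  show "poly_op D q (p + r) = poly_op D q p + poly_op D q r" for p r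
    by (induction q) (simp_all add: poly_op_0 poly_op_pCons op_add smult_add_right)
  show "poly_op D q (Polynomial.smult c p) = Polynomial.smult c (poly_op D q p)" for c p
    by (induction q) (simp_all add: poly_op_0 poly_op_pCons op_smult smult_add_right mult.commute)
qed

end

section \<open>Freeness over a degree-raising operator\<close>

locale degree_raising_operator = poly_operator D
  for D :: "'a::field poly \<Rightarrow> 'a poly" +
  fixes n :: nat
  assumes n_pos: "0 < n"
    and degree_op: "p \<noteq> 0 \<Longrightarrow> degree (D p) = degree p + n"
begin

text \<open>Each application of \<open>D\<close> adds \<open>n\<close> to the degree, so the term
  from the leading coefficient of \<open>q\<close> strictly dominates all others.\<close>

lemma poly_op_degree:
  assumes "q \<noteq> 0" "p \<noteq> 0"
  shows "poly_op D q p \<noteq> 0 \<and> degree (poly_op D q p) = degree p + n * degree q"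
  using \<open>q \<noteq> 0\<close>
proof (induction q)
  case (pCons a q)
  show ?case
  proof (cases "q = 0")
    case True
    then show ?thesis using pCons.hyps \<open>p \<noteq> 0\<close> by (simp add: poly_op_const)
  next
    case False
    let ?r = "D (poly_op D q p)"
    from pCons.IH[OF False] have r: "degree ?r = degree p + n * degree q + n"
      by (simp add: degree_op)
    then have "degree (Polynomial.smult a p) < degree ?r"
      using n_pos degree_smult_le[of a p] by linarith
    then have deg: "degree (poly_op D (pCons a q) p) = degree ?r"
      by (simp add: poly_op_pCons degree_add_eq_right)
    moreover have "poly_op D (pCons a q) p \<noteq> 0"
      using deg r n_pos by auto
    ultimately show ?thesis using False r by simp
  qed
qed simp

end

text \<open>Nothing can cancel the leading coefficient of the unique term of largest degree.\<close>

lemma sum_distinct_degrees_nonzero: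
  fixes p :: "'i \<Rightarrow> 'a::comm_monoid_add poly"
  assumes "finite I" "I \<noteq> {}" and nz: "\<And>i. i \<in> I \<Longrightarrow> p i \<noteq> 0"
    and inj: "inj_on (\<lambda>i. degree (p i)) I"
  shows "(\<Sum>i\<in>I. p i) \<noteq> 0"
proof -
  define m where "m = Max ((\<lambda>i. degree (p i)) ` I)"
  have "m \<in> (\<lambda>i. degree (p i)) ` I"
    unfolding m_def using assms(1,2) by (intro Max_in) auto
  then obtain k where k: "k \<in> I" "degree (p k) = m" by auto
  have "coeff (p i) m = 0" if "i \<in> I - {k}" for i
  proof -
    have "degree (p i) \<le> m" using that assms(1) by (auto simp: m_def)
    moreover have "degree (p i) \<noteq> m" using inj k that by (auto dest: inj_onD)
    ultimately show ?thesis by (intro coeff_eq_0) simp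
  qed
  then have "coeff (\<Sum>i\<in>I. p i) m = coeff (p k) m"
    using assms(1) k(1) by (simp add: coeff_sum sum.remove)
  also have "\<dots> \<noteq> 0" using k nz by auto
  finally show ?thesis by auto
qed

text \<open>The C[h]-linear map that sends the unit vector with index \<open>j\<close> to
  \<open>w j\<close>; it becomes the isomorphism from M(\<alpha>, a, K) onto the polynomial
  module.\<close>

definition combination ::
  "('a::comm_ring_1 poly \<Rightarrow> 'a poly) \<Rightarrow> nat \<Rightarrow> (nat \<Rightarrow> 'a poly) \<Rightarrow> 'a poly vec \<Rightarrow> 'a poly" where
  "combination D n w v = (\<Sum>j = 0..<n. poly_op D (v $ j) (w j))"

context poly_operator
begin

lemma combination_add:
  "v \<in> carrier_vec n \<Longrightarrow> v' \<in> carrier_vec n \<Longrightarrow>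
    combination D n w (v + v') = combination D n w v + combination D n w v'"
  by (simp add: combination_def poly_op_add sum.distrib)

lemma combination_scale:
  assumes "v \<in> carrier_vec n"
  shows "combination D n w (q \<cdot>\<^sub>v v) = poly_op D q (combination D n w v)"
proof -
  interpret q: poly_operator "poly_op D q" by (rule poly_operator_poly_op)
  show ?thesis using assms by (simp add: combination_def poly_op_mult q.op_sum)
qed

lemma combination_unit:
  assumes "j < n"
  shows "combination D n w (q \<cdot>\<^sub>v unit_vec n j) = poly_op D q (w j)"
proof -
  have "combination D n w (q \<cdot>\<^sub>v unit_vec n j) = (\<Sum>i = 0..<n. if i = j then poly_op D q (w j) else 0)"
    unfolding combination_def using assms by (intro sum.cong) (auto simp: poly_op_0 unit_vec_def)
  then show ?thesis using assms by simp
qed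

end

context degree_raising_operator
begin

text \<open>The polynomials \<open>D^k (w j)\<close> have degrees \<open>degree (w j) + k n\<close>,
  and each natural number occurs exactly once among these. Distinctness of degrees gives
  injectivity; the occurrence of every degree gives surjectivity by successive cancellation of
  leading terms.\<close>

lemma combination_bij:
  assumes w: "\<And>j. j < n \<Longrightarrow> w j \<noteq> 0"
    and bij: "bij_betw (\<lambda>j. degree (w j)) {0..<n} {0..<n}"
  shows "bij_betw (combination D n w) (carrier_vec n) UNIV"
proof (rule bij_betw_imageI)
  have w_less: "degree (w j) < n" if "j < n" for j
    using bij_betw_apply[OF bij, of j] that by simp
  have kernel: "v = 0\<^sub>v n" if v: "v \<in> carrier_vec n" "combination D n w v = 0" for v
  proof (rule ccontr)
    assume "v \<noteq> 0\<^sub>v n"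
    define J where "J = {j \<in> {0..<n}. v $ j \<noteq> 0}"
    have "J \<noteq> {}" using \<open>v \<noteq> 0\<^sub>v n\<close> v(1) by (auto simp: J_def)
    moreover have "inj_on (\<lambda>j. degree (poly_op D (v $ j) (w j))) J"
    proof (rule inj_onI)
      fix i j assume ij: "i \<in> J" "j \<in> J"
        "degree (poly_op D (v $ i) (w i)) = degree (poly_op D (v $ j) (w j))"
      \<comment> \<open>By \<open>w_less\<close>, reduction modulo \<open>n\<close> leaves just the
        degrees of the generators.\<close>
      then have "(degree (w i) + n * degree (v $ i)) mod n = (degree (w j) + n * degree (v $ j)) mod n"
        using w by (simp add: J_def poly_op_degree)
      then have "degree (w i) = degree (w j)"
        using ij(1,2) by (simp add: J_def w_less)
      then show "i = j"
        using ij(1,2) bij by (auto simp: J_def bij_betw_def dest: inj_onD)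
    qed
    ultimately have "(\<Sum>j\<in>J. poly_op D (v $ j) (w j)) \<noteq> 0"
      using w by (intro sum_distinct_degrees_nonzero) (auto simp: J_def poly_op_degree)
    moreover have "combination D n w v = (\<Sum>j\<in>J. poly_op D (v $ j) (w j))"
      unfolding combination_def by (rule sum.mono_neutral_right) (auto simp: J_def poly_op_0)
    ultimately show False using v(2) by simp
  qed
  show "inj_on (combination D n w) (carrier_vec n)"
  proof (rule inj_onI)
    fix u v assume uv: "u \<in> carrier_vec n" "v \<in> carrier_vec n"
      "combination D n w u = combination D n w v"
    \<comment> \<open>The difference is written with the scalar \<open>- 1\<close>, so that
      additivity and scaling of \<open>combination\<close> suffice.\<close>
    have "combination D n w (u + (- 1) \<cdot>\<^sub>v v) = 0"
      using uv by (simp add: combination_add combination_scale one_pCons poly_op_const)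
    then have "u + (- 1) \<cdot>\<^sub>v v = 0\<^sub>v n" using uv by (intro kernel) auto
    then have "(u + (- 1) \<cdot>\<^sub>v v) $ i = 0" if "i < n" for i using that by simp
    then show "u = v" using uv by (intro eq_vecI) auto
  qed
  have "p \<in> combination D n w ` carrier_vec n" for p
  \<comment> \<open>The measure ranks 0 below the nonzero constants, so that a remainder 0 counts as
    a descent even when \<open>p\<close> is constant.\<close>
  proof (induction "if p = 0 then 0 else Suc (degree p)" arbitrary: p rule: less_induct)
    case less
    show ?case
    proof (cases "p = 0")
      case True
      then have "p = combination D n w (0\<^sub>v n)" by (simp add: combination_def poly_op_0)
      then show ?thesis by (rule image_eqI) simp
    next
      case False
      \<comment> \<open>The residue of \<open>degree p\<close> modulo \<open>n\<close> selects the
        generator and the quotient selects the power of \<open>D\<close>; then \<open>r\<close> has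
        the degree of \<open>p\<close>, and \<open>c\<close> below matches the leading
        coefficients.\<close>
      have "degree p mod n \<in> (\<lambda>j. degree (w j)) ` {0..<n}"
        using bij n_pos by (simp add: bij_betw_def)
      then obtain j where j: "j < n" "degree p mod n = degree (w j)" by auto
      define x :: "'a poly" where "x = Polynomial.monom 1 (degree p div n)"
      define r where "r = poly_op D x (w j)"
      have r: "r \<noteq> 0" "degree r = degree p"
        using poly_op_degree[of x "w j"] w[OF j(1)]
        by (simp_all add: r_def x_def degree_monom_eq j(2)[symmetric])
      define c where "c = lead_coeff p / lead_coeff r"
      define q where "q = p - Polynomial.smult c r"
      have "coeff r (degree p) \<noteq> 0" using r by (metis leading_coeff_0_iff)
      then have "coeff q (degree p) = 0" using r by (simp add: q_def c_def)
      moreover have "degree q \<le> degree p"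
        unfolding q_def using r(2) degree_smult_le[of c r] by (intro degree_diff_le) auto
      ultimately have "q = 0 \<or> degree q < degree p"
        by (metis leading_coeff_0_iff le_neq_implies_less)
      then have "q \<in> combination D n w ` carrier_vec n"
        using False by (intro less) auto
      then obtain v where v: "v \<in> carrier_vec n" "q = combination D n w v" by auto
      have "combination D n w (v + ([:c:] * x) \<cdot>\<^sub>v unit_vec n j) = q + Polynomial.smult c r"
        using v j by (simp add: combination_add combination_unit poly_op_smult r_def)
      then have "p = combination D n w (v + ([:c:] * x) \<cdot>\<^sub>v unit_vec n j)"
        by (simp add: q_def)
      then show ?thesis by (rule image_eqI) (use v(1) in simp)
    qed
  qed
  then show "combination D n w ` carrier_vec n = UNIV" by auto
qed

end

section \<open>Isomorphisms onto \<open>M(\<alpha>, a, K)\<close>\<close>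

text \<open>Transport of structure: an injective linear map that intertwines the actions pulls every
  module axiom of \<open>V\<close> back to \<open>W\<close>. Hence the bracket relation on
  \<open>W\<close> is a conclusion here, not something to verify by matrix computation.\<close>

lemma sl2_isomorphicI:
  assumes V: "sl2_module V" and W: "vectorspace class_ring W"
    and hom: "\<phi> \<in> LinearCombinations.module_hom class_ring W V"
    and bij: "bij_betw \<phi> (carrier W) (carrier V)"
    and closed: "\<And>X w. w \<in> carrier W \<Longrightarrow> act W X w \<in> carrier W"
    and act: "\<And>X w. w \<in> carrier W \<Longrightarrow> \<phi> (act W X w) = act V X (\<phi> w)"
  shows "sl2_isomorphic V W"
proof -
  have V': "vectorspace class_ring V" using V by (simp add: sl2_module_def)
  interpret V: vectorspace class_ring V by (rule V')
  interpret W: vectorspace class_ring W by (rule W)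
  interpret mod_hom class_ring W V \<phi>
    by unfold_locales (rule hom)
  have inj: "x = y" if "\<phi> x = \<phi> y" "x \<in> carrier W" "y \<in> carrier W" for x y
    using that bij by (auto simp: bij_betw_def dest: inj_onD)
  have img: "\<phi> w \<in> carrier V" if "w \<in> carrier W" for w
    using that bij by (auto simp: bij_betw_def)
  have actV: "act V X \<in> LinearCombinations.module_hom class_ring V V" for X
    using V by (simp add: sl2_module_def)
  have actV_simps: "act V X v \<in> carrier V"
    "act V X (c \<odot>\<^bsub>V\<^esub> v) = c \<odot>\<^bsub>V\<^esub> act V X v"
    "v' \<in> carrier V \<Longrightarrow> act V X (v \<oplus>\<^bsub>V\<^esub> v') = act V X v \<oplus>\<^bsub>V\<^esub> act V X v'"
    if "v \<in> carrier V" for X v v' c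
    using actV[of X] that by (auto simp: LinearCombinations.module_hom_def)
  \<comment> \<open>Subtraction is addition of an abstract inverse; adding \<open>y\<close> back
    reduces the claim to additivity of \<open>\<phi>\<close>.\<close>
  have minus: "\<phi> (x \<ominus>\<^bsub>W\<^esub> y) = \<phi> x \<ominus>\<^bsub>V\<^esub> \<phi> y" if "x \<in> carrier W" "y \<in> carrier W" for x y
  proof -
    have "\<phi> (x \<ominus>\<^bsub>W\<^esub> y) \<oplus>\<^bsub>V\<^esub> \<phi> y = \<phi> ((x \<ominus>\<^bsub>W\<^esub> y) \<oplus>\<^bsub>W\<^esub> y)"
      using that by simp
    also have "(x \<ominus>\<^bsub>W\<^esub> y) \<oplus>\<^bsub>W\<^esub> y = x"
      using that by (simp add: a_minus_def W.a_assoc W.l_neg)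
    finally show ?thesis
      using that img by (metis V.minus_closed V.add.inv_solve_right W.minus_closed a_minus_def)
  qed
  have W_mod: "sl2_module W"
    unfolding sl2_module_def
  proof (intro conjI allI ballI W)
    fix X show "act W X \<in> LinearCombinations.module_hom class_ring W W"
      unfolding LinearCombinations.module_hom_def
      by (auto intro!: inj simp: closed act img actV_simps)
  next
    fix X Y v assume v: "v \<in> carrier W"
    show "act W (sl2_add X Y) v = act W X v \<oplus>\<^bsub>W\<^esub> act W Y v"
      using V v by (intro inj) (simp_all add: closed act img sl2_module_def)
    show "act W (sl2_bracket X Y) v = act W X (act W Y v) \<ominus>\<^bsub>W\<^esub> act W Y (act W X v)"
      using V v by (intro inj) (simp_all add: closed act img minus sl2_module_def)
  next
    fix c X v assume v: "v \<in> carrier W"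
    show "act W (sl2_scale c X) v = c \<odot>\<^bsub>W\<^esub> act W X v"
      using V v by (intro inj) (simp_all add: closed act img sl2_module_def)
  qed
  \<comment> \<open>Isomorphy of \<open>V\<close> with \<open>W\<close> asks for a map out of
    \<open>V\<close>, so \<open>\<phi>\<close> is inverted; linearity and equivariance of the
    inverse follow by applying \<open>\<phi>\<close> to both sides.\<close>
  define \<psi> where "\<psi> = inv_into (carrier W) \<phi>"
  have \<psi>: "bij_betw \<psi> (carrier V) (carrier W)"
    unfolding \<psi>_def by (rule bij_betw_inv_into[OF bij])
  have \<psi>_closed: "\<psi> v \<in> carrier W" and \<phi>_\<psi>: "\<phi> (\<psi> v) = v" if "v \<in> carrier V" for v
    using that bij by (auto simp: \<psi>_def bij_betw_def inv_into_into f_inv_into_f)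
  have "\<psi> \<in> LinearCombinations.module_hom class_ring V W"
    unfolding LinearCombinations.module_hom_def
    by (auto intro!: inj simp: \<psi>_closed \<phi>_\<psi>)
  moreover have "\<psi> (act V X v) = act W X (\<psi> v)" if "v \<in> carrier V" for X v
    using that by (intro inj) (simp_all add: \<psi>_closed \<phi>_\<psi> closed act actV_simps)
  ultimately show ?thesis
    using V W_mod \<psi> unfolding sl2_isomorphic_def by blast
qed

section \<open>The underlying complex vector spaces\<close>

lemma vectorspace_exp_poly_space: "vectorspace class_ring exp_poly_space"
proof -
  interpret abelian_group exp_poly_space
    by (unfold_locales) (auto simp: exp_poly_space_def Units_def intro: exI[of _ "- _"] add.right_inverse)
  show ?thesis
    by (unfold_locales) (auto simp: exp_poly_space_def smult_add_left smult_add_right)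
qed

lemma poly_vec_space_simps [simp]:
  "carrier (poly_vec_space n) = carrier_vec n" "zero (poly_vec_space n) = 0\<^sub>v n"
  "add (poly_vec_space n) = (+)" "module.smult (poly_vec_space n) c v = [:c:] \<cdot>\<^sub>v v"
  by (simp_all add: poly_vec_space_def)
lemma vectorspace_poly_vec_space: "vectorspace class_ring (poly_vec_space n)"
proof -
  interpret abelian_group "poly_vec_space n"
  proof (rule abelian_groupI)
    fix v assume "v \<in> carrier (poly_vec_space n)"
    then show "\<exists>u\<in>carrier (poly_vec_space n). u \<oplus>\<^bsub>poly_vec_space n\<^esub> v = \<zero>\<^bsub>poly_vec_space n\<^esub>"
      by (intro bexI[of _ "- v"]) auto
  qed (auto simp: comm_add_vec[of _ n])
  \<comment> \<open>Scalars act as constant polynomials, so the vector space axioms reduce to the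
    module axioms over C[h].\<close>
  have "[:c + d:] = [:c:] + [:d:]" "[:c * d:] = [:c:] * [:d:]" for c d :: complex by simp_all
  then show ?thesis
    by (unfold_locales) (simp_all add: smult_add_distrib_vec smult_smult_assoc add_smult_distrib_vec
      del: add_pCons mult_pCons_left mult_pCons_right flip: one_pCons)
qed

lemma with_sl2_action_simps [simp]:
  "carrier (with_sl2_action V e f h) = carrier V"
  "monoid.mult (with_sl2_action V e f h) = monoid.mult V"
  "one (with_sl2_action V e f h) = one V"
  "zero (with_sl2_action V e f h) = zero V"
  "add (with_sl2_action V e f h) = add V"
  "module.smult (with_sl2_action V e f h) = module.smult V"
  "act (with_sl2_action V e f h) X v =
    e_coord X \<odot>\<^bsub>V\<^esub> e v \<oplus>\<^bsub>V\<^esub> f_coord X \<odot>\<^bsub>V\<^esub> f v \<oplus>\<^bsub>V\<^esub> h_coord X \<odot>\<^bsub>V\<^esub> h v"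
  by (simp_all add: with_sl2_action_def module.defs sl2_rep.defs)

text \<open>Unfolded down to record fields, the axioms mention only fields that adding an action
  leaves unchanged.\<close>

lemma vectorspace_with_sl2_action:
  "vectorspace class_ring (with_sl2_action V e f h) \<longleftrightarrow> vectorspace class_ring V"
  by (simp add: vectorspace_def Module.module_def Module.module_axioms_def abelian_group_def
      abelian_group_axioms_def abelian_monoid_def comm_group_def comm_monoid_def
      comm_monoid_axioms_def monoid_def group_def group_axioms_def Units_def)

lemma exp_poly_space_simps [simp]:
  "carrier exp_poly_space = UNIV" "zero exp_poly_space = 0" "add exp_poly_space = (+)"
  "module.smult exp_poly_space = Polynomial.smult"
  by (simp_all add: exp_poly_space_def)

section \<open>Invertible matrices and the composite f e on M(\<alpha>, a, K)\<close>

lemma const_mat_GL: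
  assumes "K \<in> GL TYPE(complex) n"
  shows "const_mat K \<in> GL TYPE(complex poly) n"
proof -
  interpret const: comm_ring_hom "\<lambda>c :: complex. [:c:]"
    by unfold_locales (simp_all add: one_pCons)
  from assms obtain L where KL: "K \<in> carrier_mat n n" "L \<in> carrier_mat n n"
    "L * K = 1\<^sub>m n" "K * L = 1\<^sub>m n"
    by (auto simp: Units_def ring_mat_simps)
  then have "const_mat L * const_mat K = 1\<^sub>m n" "const_mat K * const_mat L = 1\<^sub>m n"
    by (metis const.mat_hom_mult const.mat_hom_one)+
  then show ?thesis using KL(1,2) by (auto simp: Units_def ring_mat_simps intro!: bexI[of _ "const_mat L"])
qed

lemma GL_inv_mult:
  assumes "K \<in> GL TYPE(complex poly) n"
  shows "GL_inv n K \<in> carrier_mat n n" "K * GL_inv n K = 1\<^sub>m n"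
proof -
  interpret ring "ring_mat TYPE(complex poly) n ()" by (rule ring_mat)
  show "GL_inv n K \<in> carrier_mat n n" "K * GL_inv n K = 1\<^sub>m n"
    using Units_inv_closed[OF assms] Units_r_inv[OF assms]
    by (simp_all add: GL_inv_def ring_mat_simps)
qed

text \<open>The two shifts cancel, which leaves the product of \<open>P K\<close> with the inverse
  of \<open>K\<close> times \<open>P_bar\<close>; the factors \<open>K\<close> cancel next, and P
  times its complement is the scalar \<open>lam \<alpha>\<close>.\<close>

lemma M_alpha_fe:
  assumes "size3 m = n" "K \<in> GL TYPE(complex poly) n" "v \<in> carrier_vec n"
  shows "(P_mat m \<alpha> * K) *\<^sub>v map_vec shift_inv
      (map_mat shift (GL_inv n K * P_bar m \<alpha>) *\<^sub>v map_vec shift v) = lam \<alpha> \<cdot>\<^sub>v v"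
proof -
  interpret shift_inv: comm_ring_hom shift_inv
    by unfold_locales
      (simp_all add: shift_inv_def pcompose_add pcompose_mult pcompose_1 pcompose_uminus)
  define L where "L = GL_inv n K"
  have carr: "K \<in> carrier_mat n n" "L \<in> carrier_mat n n" "K * L = 1\<^sub>m n"
    using assms(2) GL_inv_mult[OF assms(2)] by (auto simp: Units_def ring_mat_simps L_def)
  have P: "P_mat m \<alpha> \<in> carrier_mat n n" "P_bar m \<alpha> \<in> carrier_mat n n"
    using assms(1) by (simp_all add: P_mat_def P_bar_def)
  \<comment> \<open>Diagonal matrices commute, so \<open>P_bar_mult\<close> also holds in this
    order.\<close>
  have PP: "P_mat m \<alpha> * P_bar m \<alpha> = lam \<alpha> \<cdot>\<^sub>m 1\<^sub>m n"
    using P_bar_mult[of m \<alpha>] assms(1) by (simp add: P_mat_def P_bar_def mult.commute)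
  have LP: "L * P_bar m \<alpha> \<in> carrier_mat n n" using carr P by simp
  have "map_vec shift_inv (map_mat shift (L * P_bar m \<alpha>) *\<^sub>v map_vec shift v) =
      map_mat shift_inv (map_mat shift (L * P_bar m \<alpha>)) *\<^sub>v map_vec shift_inv (map_vec shift v)"
    using LP assms(3) by (intro shift_inv.mult_mat_vec_hom[where nr = n and n = n]) auto
  also have "map_mat shift_inv (map_mat shift (L * P_bar m \<alpha>)) = L * P_bar m \<alpha>"
    using LP by (intro eq_matI) (auto simp: shift_inverse)
  also have "map_vec shift_inv (map_vec shift v) = v"
    by (intro eq_vecI) (auto simp: shift_inverse)
  finally have "(P_mat m \<alpha> * K) *\<^sub>v map_vec shift_inv
      (map_mat shift (L * P_bar m \<alpha>) *\<^sub>v map_vec shift v) =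
      (P_mat m \<alpha> * K * (L * P_bar m \<alpha>)) *\<^sub>v v"
    using carr P LP assms(3) by (simp add: assoc_mult_mat_vec[of _ n n _ n])
  also have "P_mat m \<alpha> * K * (L * P_bar m \<alpha>) = P_mat m \<alpha> * (K * (L * P_bar m \<alpha>))"
    using carr P LP by (intro assoc_mult_mat) auto
  also have "K * (L * P_bar m \<alpha>) = K * L * P_bar m \<alpha>"
    using carr P by (intro assoc_mult_mat[symmetric]) auto
  also have "P_mat m \<alpha> * (K * L * P_bar m \<alpha>) = lam \<alpha> \<cdot>\<^sub>m 1\<^sub>m n"
    using carr P PP by simp
  also have "\<dots> *\<^sub>v v = lam \<alpha> \<cdot>\<^sub>v v"
    using assms(3) by (intro eq_vecI) auto
  finally show ?thesis by (simp add: L_def)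
qed

lemma exp_poly_space_minus: "x \<ominus>\<^bsub>with_sl2_action exp_poly_space e f h\<^esub> y = x - y"
proof -
  interpret vectorspace class_ring "with_sl2_action exp_poly_space e f h"
    by (simp add: vectorspace_with_sl2_action vectorspace_exp_poly_space)
  have "(x \<ominus>\<^bsub>with_sl2_action exp_poly_space e f h\<^esub> y) + y = x"
    using M.a_assoc[of x "\<ominus>\<^bsub>with_sl2_action exp_poly_space e f h\<^esub> y" y] M.l_neg[of y] 
    by (simp add: a_minus_def)
  then show ?thesis by (simp add: eq_diff_eq)
qed

section \<open>sl(2)-actions on C[t] and the isomorphism criterion\<close>

locale poly_sl2_action =
  e: poly_operator e + f: poly_operator f + h: poly_operator h
  for e f h :: "complex poly \<Rightarrow> complex poly" +
  assumes he: "h (e p) - e (h p) = e p"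
    and hf: "h (f p) - f (h p) = - f p"
    and ef: "e (f p) - f (e p) = Polynomial.smult 2 (h p)"
begin

lemma sl2_module: "sl2_module (with_sl2_action exp_poly_space e f h)"
proof -
  \<comment> \<open>As rewrite rules these bring every composite into the order f, e, h, so both
    sides of the bracket axiom reach one normal form.\<close>
  have comm: "h (e p) = e (h p) + e p" "h (f p) = f (h p) - f p"
    "e (f p) = f (e p) + Polynomial.smult 2 (h p)" for p
    using he[of p] hf[of p] ef[of p] by (simp_all add: algebra_simps)
  show ?thesis
    by (auto simp: sl2_module_def LinearCombinations.module_hom_def vectorspace_with_sl2_action
        vectorspace_exp_poly_space exp_poly_space_minus sl2_add_def sl2_scale_def sl2_bracket_def 
        e.op_add f.op_add h.op_add e.op_smult f.op_smult h.op_smult comm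
        smult_add_left smult_add_right smult_diff_left smult_diff_right algebra_simps)
qed

text \<open>The relation \<open>[h,f] = -f\<close> reads f h = (h + 1) f, hence f q(h) = q(h + 1)
  f.\<close>

lemma f_poly_op: "f (poly_op h q p) = poly_op h (shift_inv q) (f p)"
proof (induction q)
  case 0
  then show ?case by (simp add: shift_inv_def h.poly_op_0 f.op_zero)
next
  case (pCons c q)
  have "f (h r) = h (f r) + f r" for r
    using hf[of r] by (simp add: algebra_simps)
  then show ?case
    using pCons
    by (simp add: shift_inv_def pcompose_pCons h.poly_op_pCons h.poly_op_add h.poly_op_smult
        f.op_add f.op_smult h.poly_op_0 h.op_zero add_ac)
qed

text \<open>The hypothesis \<open>f_w\<close> says that f has matrix \<open>P K\<close> in the
  C[h]-basis \<open>w\<close>. Together with \<open>fe\<close> and injectivity of f this determines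
  e as well.\<close>

lemma isomorphic_M_alpha:
  assumes m: "size3 m = n" and K: "K \<in> GL TYPE(complex) n"
    and h: "degree_raising_operator h n"
    and w: "\<And>j. j < n \<Longrightarrow> w j \<noteq> 0"
    and w_bij: "bij_betw (\<lambda>j. degree (w j)) {0..<n} {0..<n}"
    and f_w: "\<And>j. j < n \<Longrightarrow>
      f (w j) = (\<Sum>i = 0..<n. Polynomial.smult (K $$ (i, j)) (poly_op h (P_entry m \<alpha> i) (w i)))"
    and f_inj: "\<And>p. f p = 0 \<Longrightarrow> p = 0"
    and fe: "\<And>p. f (e p) = poly_op h (lam \<alpha>) p"
  shows "sl2_isomorphic (with_sl2_action exp_poly_space e f h) (M_alpha \<alpha> m (const_mat K))"
proof -
  interpret h: degree_raising_operator h n by (rule h)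
  let ?\<phi> = "combination h n w"
  define F where "F = P_mat m \<alpha> * const_mat K"
  define E where "E = map_mat shift (GL_inv n (const_mat K) * P_bar m \<alpha>)"
  have K': "const_mat K \<in> carrier_mat n n" using K by (simp add: Units_def ring_mat_simps)
  have F: "F \<in> carrier_mat n n" using m K' by (simp add: F_def P_mat_def mult_carrier_mat[of _ n n])
  have F_entry: "F $$ (i, j) = [:K $$ (i, j):] * P_entry m \<alpha> i" if "i < n" "j < n" for i j
    using that m K' by (simp add: F_def P_mat_def mat_diag_mult_left[of _ n n] mult.commute)
  have E: "E \<in> carrier_mat n n"
    using m GL_inv_mult[OF const_mat_GL[OF K]] by (auto simp: E_def P_bar_def)
  have \<phi>_f: "?\<phi> (F *\<^sub>v map_vec shift_inv v) = f (?\<phi> v)" if v: "v \<in> carrier_vec n" for v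
  proof -
    \<comment> \<open>The factor \<open>shift_inv (v $ j)\<close> is put first so that its operator
      is applied last; it then leaves the sum over \<open>i\<close>, where \<open>f_w\<close>
      applies.\<close>
    have "?\<phi> (F *\<^sub>v map_vec shift_inv v) =
        (\<Sum>i = 0..<n. poly_op h (\<Sum>j = 0..<n. shift_inv (v $ j) * F $$ (i, j)) (w i))"
      unfolding combination_def using F v
      by (intro sum.cong refl arg_cong2[where f = "poly_op h"]) (auto simp: scalar_prod_def mult.commute)
    also have "\<dots> = (\<Sum>i = 0..<n. \<Sum>j = 0..<n. poly_op h (shift_inv (v $ j)) (poly_op h (F $$ (i, j)) (w i)))"
      by (simp add: h.poly_op_sum h.poly_op_mult)
    also have "\<dots> = (\<Sum>j = 0..<n. \<Sum>i = 0..<n. poly_op h (shift_inv (v $ j)) (poly_op h (F $$ (i, j)) (w i)))"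
      by (rule sum.swap)
    also have "\<dots> = (\<Sum>j = 0..<n. poly_op h (shift_inv (v $ j)) (f (w j)))"
      by (intro sum.cong refl)
        (simp add: f_w F_entry h.poly_op_smult poly_operator.op_sum[OF h.poly_operator_poly_op])
    also have "\<dots> = f (?\<phi> v)"
      by (simp add: combination_def f.op_sum f_poly_op)
    finally show ?thesis .
  qed
  have \<phi>_e: "?\<phi> (E *\<^sub>v map_vec shift v) = e (?\<phi> v)" if v: "v \<in> carrier_vec n" for v
  proof -
    have Ev: "E *\<^sub>v map_vec shift v \<in> carrier_vec n" using E v by auto
    \<comment> \<open>Both sides are compared after applying f: \<open>M_alpha_fe\<close> produces
      \<open>lam \<alpha>\<close> on vectors, C[h]-linearity carries it to polynomials, and
      \<open>fe\<close> turns it back into f e.\<close>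
    have "f (?\<phi> (E *\<^sub>v map_vec shift v)) = ?\<phi> (lam \<alpha> \<cdot>\<^sub>v v)"
      using M_alpha_fe[OF m const_mat_GL[OF K] v, of \<alpha>]
      by (simp only: \<phi>_f[OF Ev, symmetric]) (simp only: E_def F_def)
    also have "\<dots> = f (e (?\<phi> v))"
      by (simp add: h.combination_scale[OF v] fe)
    finally have "f (?\<phi> (E *\<^sub>v map_vec shift v) - e (?\<phi> v)) = 0"
      by (simp add: f.op_diff)
    then show ?thesis using f_inj by fastforce
  qed
  have \<phi>_h: "?\<phi> ([:0, 1:] \<cdot>\<^sub>v v) = h (?\<phi> v)" if v: "v \<in> carrier_vec n" for v
    by (simp add: h.combination_scale[OF v] h.poly_op_pCons h.poly_op_0 h.op_zero)
  have \<phi>_c: "?\<phi> ([:c:] \<cdot>\<^sub>v v) = Polynomial.smult c (?\<phi> v)" if v: "v \<in> carrier_vec n" for v c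
    by (simp add: h.combination_scale[OF v] h.poly_op_const)
  let ?M = "with_sl2_action (poly_vec_space n)
     (\<lambda>v. E *\<^sub>v map_vec shift v) (\<lambda>v. F *\<^sub>v map_vec shift_inv v) (\<lambda>v. [:0, 1:] \<cdot>\<^sub>v v)"
  have M: "M_alpha \<alpha> m (const_mat K) = ?M"
    by (simp add: M_alpha_def M_mod_def m E_def F_def)
  show ?thesis
    unfolding M
  proof (rule sl2_isomorphicI[where \<phi> = ?\<phi>])
    show "?\<phi> \<in> LinearCombinations.module_hom class_ring ?M
      (with_sl2_action exp_poly_space e f h)"
      by (auto simp: LinearCombinations.module_hom_def h.combination_add \<phi>_c)
    show "bij_betw ?\<phi> (carrier ?M) (carrier (with_sl2_action exp_poly_space e f h))"
      using h.combination_bij[OF w w_bij] by simp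
  next
    fix X v assume "v \<in> carrier ?M"
    then have v: "v \<in> carrier_vec n" by simp
    have Ev: "E *\<^sub>v map_vec shift v \<in> carrier_vec n" and Fv: "F *\<^sub>v map_vec shift_inv v \<in> carrier_vec n"
      using E F v by auto
    show "act ?M X v \<in> carrier ?M"
      using v Ev Fv by (simp del: mult_mat_vec_carrier)
    show "?\<phi> (act ?M X v) = act (with_sl2_action exp_poly_space e f h) X (?\<phi> v)"
      using v Ev Fv
      by (simp add: h.combination_add[of _ n] \<phi>_c \<phi>_e \<phi>_f \<phi>_h)
  qed (simp_all add: sl2_module vectorspace_with_sl2_action vectorspace_poly_vec_space)
qed

end

section \<open>Invertibility of \<open>K\<^sub>1\<close> and \<open>K\<^sub>2\<close>\<close>

text \<open>The kernel is trivial: the last row has the single nonzero entry \<open>- n a n\<close>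
  and forces \<open>v $ 0 = 0\<close>, after which row \<open>i - 1\<close> forces
  \<open>v $ i = 0\<close>.\<close>

lemma K1_mat_GL:
  assumes "0 < n" "a n \<noteq> 0"
  shows "K1_mat n a \<in> GL TYPE(complex) n"
proof (rule det_non_zero_imp_unit)
  show carr: "K1_mat n a \<in> carrier_mat n n" by (simp add: K1_mat_def)
  obtain N where n: "n = Suc N" using assms(1) by (cases n) auto
  have "v = 0\<^sub>v n" if v: "v \<in> carrier_vec n" "K1_mat n a *\<^sub>v v = 0\<^sub>v n" for v
  proof -
    have row: "- of_nat (Suc i) * a (Suc i) * v $ 0 + (if i < N then - (v $ Suc i) else 0) = 0" if i: "i < n" for i
    proof -
      have "0 = (K1_mat n a *\<^sub>v v) $ i" using v(2) i by simp
      also have "\<dots> = (\<Sum>j = 0..<n. K1_mat n a $$ (i, j) * v $ j)"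
        using v(1) i carr by (simp add: scalar_prod_def)
      also have "\<dots> = K1_mat n a $$ (i, 0) * v $ 0 + (\<Sum>j = 0..<N. K1_mat n a $$ (i, Suc j) * v $ Suc j)"
        unfolding n by (simp add: sum.atLeast0_lessThan_Suc_shift del: sum.op_ivl_Suc)
      also have "(\<Sum>j = 0..<N. K1_mat n a $$ (i, Suc j) * v $ Suc j) =
          (\<Sum>j = 0..<N. if j = i then - (v $ Suc i) else 0)"
        using i by (intro sum.cong) (auto simp: K1_mat_def n)
      finally show ?thesis using i by (simp add: K1_mat_def)
    qed
    have "v $ 0 = 0" using row[of N] assms(2) unfolding n by (simp del: of_nat_Suc)
    then have "v $ i = 0" if "i < n" for i
      using row[of "i - 1"] that by (cases i) (auto simp: n)
    then show ?thesis using v(1) by (intro eq_vecI) auto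
  qed
  then show "det (K1_mat n a) \<noteq> 0" using det_0_iff_vec_prod_zero_field[OF carr] by blast
qed

text \<open>The kernel is trivial: the last row kills entry \<open>n - 2\<close>, the middle rows
  then kill the entries before it, and row 0 kills the last one.\<close>

lemma K2_mat_GL:
  assumes "2 \<le> n" "a n \<noteq> 0"
  shows "K2_mat n a \<in> GL TYPE(complex) n"
proof (rule det_non_zero_imp_unit)
  show carr: "K2_mat n a \<in> carrier_mat n n" by (simp add: K2_mat_def)
  \<comment> \<open>With \<open>n = m + 2\<close>, the columns below \<open>m\<close> are pure
    shifts, and \<open>m\<close> and \<open>Suc m\<close> are the two exceptional ones.\<close>
  obtain m where n: "n = Suc (Suc m)" using assms(1) by (metis add_2_eq_Suc le_Suc_ex)
  have "v = 0\<^sub>v n" if v: "v \<in> carrier_vec n" "K2_mat n a *\<^sub>v v = 0\<^sub>v n" for v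
  proof -
    have row: "(\<Sum>j = 0..<m. if i = Suc j then v $ j else 0) + K2_mat n a $$ (i, m) * v $ m
        + K2_mat n a $$ (i, Suc m) * v $ Suc m = 0" if i: "i < n" for i
    proof -
      have "0 = (K2_mat n a *\<^sub>v v) $ i" using v(2) i by simp
      also have "\<dots> = (\<Sum>j = 0..<n. K2_mat n a $$ (i, j) * v $ j)"
        using v(1) i carr by (simp add: scalar_prod_def)
      also have "\<dots> = (\<Sum>j = 0..<m. K2_mat n a $$ (i, j) * v $ j) + K2_mat n a $$ (i, m) * v $ m
          + K2_mat n a $$ (i, Suc m) * v $ Suc m"
        unfolding n by simp
      also have "(\<Sum>j = 0..<m. K2_mat n a $$ (i, j) * v $ j) =
          (\<Sum>j = 0..<m. if i = Suc j then v $ j else 0)"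
        using i by (intro sum.cong) (auto simp: K2_mat_def n)
      finally show ?thesis by simp
    qed
    have m0: "v $ m = 0" using row[of "Suc m"] by (simp add: n K2_mat_def)
    have "v $ i = 0" if "i < m" for i
      using row[of "Suc i"] m0 that by (simp add: n K2_mat_def)
    moreover have "v $ Suc m = 0"
      using row[of 0] m0 assms(2) unfolding n by (simp add: K2_mat_def del: of_nat_Suc)
    ultimately have "v $ i = 0" if "i < n" for i
      using m0 that by (auto simp: n less_Suc_eq)
    then show ?thesis using v(1) by (intro eq_vecI) auto
  qed
  then show "det (K2_mat n a) \<noteq> 0" using det_0_iff_vec_prod_zero_field[OF carr] by blast
qed

section \<open>The Weyl algebra actions\<close>

lemma mult_t_add: "mult_t (p + q) = mult_t p + mult_t q"
  and mult_t_uminus: "mult_t (- p) = - mult_t p"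
  and mult_t_diff: "mult_t (p - q) = mult_t p - mult_t q"
  and mult_t_smult: "mult_t (Polynomial.smult c p) = Polynomial.smult c (mult_t p)"
  and mult_t_eq_0_iff: "mult_t p = 0 \<longleftrightarrow> p = 0"
  and mult_t_monom: "mult_t (Polynomial.monom c k) = Polynomial.monom c (Suc k)"
  by (simp_all add: mult_t_def algebra_simps smult_add_right smult_diff_right monom_Suc)

lemma del_add: "del g (p + q) = del g p + del g q"
  and del_uminus: "del g (- p) = - del g p"
  and del_diff: "del g (p - q) = del g p - del g q"
  and del_smult: "del g (Polynomial.smult c p) = Polynomial.smult c (del g p)"
  and del_mult_t: "del g (mult_t p) = p + mult_t (del g p)"
  by (simp_all add: del_def mult_t_def pderiv_add pderiv_minus pderiv_diff pderiv_smult pderiv_mult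
      pderiv_pCons algebra_simps smult_add_right)

text \<open>Normal ordering in the Weyl algebra: \<open>del_mult_t\<close> moves every derivation
  inside the multiplications by t.\<close>

lemmas weyl_simps =
  mult_t_add mult_t_uminus mult_t_diff mult_t_smult
  del_add del_uminus del_diff del_smult del_mult_t
  smult_add_left smult_add_right smult_diff_left smult_diff_right

lemma numeral_mult_poly: "numeral k * p = Polynomial.smult (numeral k) p"
  "p * numeral k = Polynomial.smult (numeral k) p"
  for p :: "'a::comm_semiring_1 poly"
  by (simp_all add: numeral_poly)

lemma poly_sl2_action_T1:
  "poly_sl2_action (\<lambda>p. mult_t (mult_t (del g p)) + Polynomial.smult (2 * b) (mult_t p))
     (\<lambda>p. - del g p) (\<lambda>p. mult_t (del g p) + Polynomial.smult b p)"
  by unfold_locales (simp_all add: weyl_simps numeral_mult_poly algebra_simps)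

lemma poly_sl2_action_T2:
  "poly_sl2_action (\<lambda>p. - mult_t (del g (del g p)) + Polynomial.smult (2 * b - 2) (del g p))
     mult_t (\<lambda>p. - mult_t (del g p) + Polynomial.smult (b - 1) p)"
  by unfold_locales (simp_all add: weyl_simps numeral_mult_poly algebra_simps)

section \<open>Degrees under t and the derivation\<close>

lemma degree_mult_t: "p \<noteq> 0 \<Longrightarrow> degree (mult_t p) = Suc (degree p)"
  by (simp add: mult_t_def)

text \<open>Since g' has positive degree, \<open>p g'\<close> has larger degree than
  \<open>p'\<close>. The form with \<open>Suc\<close> avoids truncated subtraction.\<close>

lemma degree_del:
  assumes "2 \<le> degree g" "p \<noteq> 0"
  shows "Suc (degree (del g p)) = degree p + degree g"
proof -
  have "pderiv g \<noteq> 0" using assms(1) by (simp add: pderiv_eq_0_iff)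
  then have "degree (p * pderiv g) = degree p + (degree g - 1)"
    using assms(2) by (simp add: degree_mult_eq degree_pderiv)
  moreover have "degree (pderiv p) \<le> degree p" by (simp add: degree_pderiv)
  ultimately show ?thesis
    using assms(1) unfolding del_def by (subst degree_add_eq_right) auto
qed

lemma del_eq_0_iff:
  assumes "2 \<le> degree g"
  shows "del g p = 0 \<longleftrightarrow> p = 0"
proof
  assume "del g p = 0"
  then show "p = 0" using degree_del[OF assms, of p] assms by (cases "p = 0") auto
qed (simp add: del_def)

lemma degree_raising_T1:
  assumes "2 \<le> degree g"
  shows "degree_raising_operator (\<lambda>p. mult_t (del g p) + Polynomial.smult c p) (degree g)"
proof unfold_locales
  fix p :: "complex poly" assume p: "p \<noteq> 0"
  have "degree (mult_t (del g p)) = degree p + degree g"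
    using degree_del[OF assms p] p by (simp add: degree_mult_t del_eq_0_iff[OF assms])
  then show "degree (mult_t (del g p) + Polynomial.smult c p) = degree p + degree g"
    using assms degree_smult_le[of c p] by (subst degree_add_eq_left) auto
qed (use assms in \<open>auto simp: weyl_simps algebra_simps\<close>)

lemma degree_raising_T2:
  assumes "2 \<le> degree g"
  shows "degree_raising_operator (\<lambda>p. - mult_t (del g p) + Polynomial.smult c p) (degree g)"
proof unfold_locales
  fix p :: "complex poly" assume p: "p \<noteq> 0"
  have "degree (mult_t (del g p)) = degree p + degree g"
    using degree_del[OF assms p] p by (simp add: degree_mult_t del_eq_0_iff[OF assms])
  then show "degree (- mult_t (del g p) + Polynomial.smult c p) = degree p + degree g"
    using assms degree_smult_le[of c p] by (subst degree_add_eq_left) auto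
qed (use assms in \<open>auto simp: weyl_simps algebra_simps\<close>)

section \<open>The two isomorphisms\<close>

lemma T1_isomorphic:
  assumes g: "degree g = n" "2 \<le> n" "\<And>i. i < n \<Longrightarrow> coeff g (Suc i) = a (Suc i)"
  shows "sl2_isomorphic (T1 g b) (M_alpha b (1, n - 1, 0) (const_mat (K1_mat n a)))"
proof -
  define h where "h = (\<lambda>p. mult_t (del g p) + Polynomial.smult b p)"
  interpret poly_sl2_action "\<lambda>p. mult_t (mult_t (del g p)) + Polynomial.smult (2 * b) (mult_t p)"
    "\<lambda>p. - del g p" h
    unfolding h_def by (rule poly_sl2_action_T1)
  \<comment> \<open>The basis is chosen so that \<open>P w\<close> consists of the \<partial> t^i:
    the entry 1 meets g' = \<partial> 1, and h - b + 1 = t \<partial> + 1 = \<partial> t sends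
    t^(i-1) to \<partial> t^i.\<close>
  define w where "w = (\<lambda>j. if j = 0 then pderiv g else Polynomial.monom 1 (j - 1))"
  have an: "a n = lead_coeff g" using g(1,2) g(3)[of "n - 1"] by simp
  have P_w: "poly_op h (P_entry (1, n - 1, 0) b i) (w i) = del g (Polynomial.monom 1 i)" if "i < n" for i
  proof (cases i)
    case 0
    then show ?thesis by (simp add: w_def one_pCons h.poly_op_const del_def monom_0)
  next
    case (Suc k)
    then have "poly_op h (P_entry (1, n - 1, 0) b i) (w i) = del g (mult_t (w i))"
      using that by (simp add: h.poly_op_pCons h.poly_op_0 h.op_zero) (simp add: h_def weyl_simps)
    then show ?thesis using Suc by (simp add: w_def mult_t_monom)
  qed
  \<comment> \<open>Since f = -\<partial>, column \<open>j\<close> of \<open>K1_mat\<close> must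
    list the monomial coefficients of \<open>- w j\<close>.\<close>
  have K_w: "(\<Sum>i = 0..<n. Polynomial.smult (K1_mat n a $$ (i, j)) (Polynomial.monom 1 i)) = - w j"
    if "j < n" for j
  proof (rule poly_eqI)
    fix k
    have "coeff (\<Sum>i = 0..<n. Polynomial.smult (K1_mat n a $$ (i, j)) (Polynomial.monom 1 i)) k =
        (\<Sum>i = 0..<n. if i = k then K1_mat n a $$ (k, j) else 0)"
      unfolding coeff_sum by (intro sum.cong) auto
    also have "\<dots> = coeff (- w j) k"
      using that g by (auto simp: K1_mat_def w_def coeff_pderiv coeff_eq_0 simp del: of_nat_Suc)
    finally show "coeff (\<Sum>i = 0..<n. Polynomial.smult (K1_mat n a $$ (i, j)) (Polynomial.monom 1 i)) k =
        coeff (- w j) k" .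
  qed
  interpret del: poly_operator "del g" by unfold_locales (simp_all add: weyl_simps)
  show ?thesis
    unfolding T1_def h_def[symmetric]
  proof (rule isomorphic_M_alpha[where w = w])
    show "K1_mat n a \<in> GL TYPE(complex) n"
      using g(1,2) an by (intro K1_mat_GL) auto
    show "degree_raising_operator h n"
      using degree_raising_T1[of g b] g(1,2) by (simp add: h_def)
    show "w j \<noteq> 0" if "j < n" for j
      using g(1,2) by (auto simp: w_def pderiv_eq_0_iff)
    have deg: "degree (w j) = (if j = 0 then n - 1 else j - 1)" for j
      using g(1) by (simp add: w_def degree_pderiv degree_monom_eq)
    \<comment> \<open>The degrees are n-1, 0, 1, ..., n-2, a cyclic shift.\<close>
    show "bij_betw (\<lambda>j. degree (w j)) {0..<n} {0..<n}"
      unfolding deg using g(2)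
      by (intro bij_betw_byWitness[where f' = "\<lambda>i. if i = n - 1 then 0 else Suc i"]) auto
    show "- del g (w j) = (\<Sum>i = 0..<n. Polynomial.smult (K1_mat n a $$ (i, j))
        (poly_op h (P_entry (1, n - 1, 0) b i) (w i)))" if "j < n" for j
    proof -
      have "- del g (w j) =
          del g (\<Sum>i = 0..<n. Polynomial.smult (K1_mat n a $$ (i, j)) (Polynomial.monom 1 i))"
        using K_w[OF that] by (simp only: del_uminus)
      also have "\<dots> =
          (\<Sum>i = 0..<n. Polynomial.smult (K1_mat n a $$ (i, j)) (del g (Polynomial.monom 1 i)))"
        by (simp only: del.op_sum del_smult)
      finally show ?thesis by (rule trans) (rule sum.cong[OF refl], simp only: P_w atLeast0LessThan lessThan_iff)
    qed
    show "p = 0" if "- del g p = 0" for p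
      using that g(1,2) by (simp add: del_eq_0_iff)
    \<comment> \<open>Both sides are -(t \<partial> + 1)(t \<partial> + 2b).\<close>
    show "- del g (mult_t (mult_t (del g p)) + Polynomial.smult (2 * b) (mult_t p)) = poly_op h (lam b) p" for p
      by (simp add: lam_def h.poly_op_pCons h.poly_op_0 h.op_zero)
        (simp add: h_def weyl_simps numeral_mult_poly algebra_simps)
  qed (use g in simp)
qed

lemma T2_isomorphic:
  assumes g: "degree g = n" "2 \<le> n" "\<And>i. i < n \<Longrightarrow> coeff g (Suc i) = a (Suc i)"
  shows "sl2_isomorphic (T2 g b) (M_alpha b (n - 1, 1, 0) (const_mat (K2_mat n a)))"
proof -
  define h where "h = (\<lambda>p. - mult_t (del g p) + Polynomial.smult (b - 1) p)"
  interpret poly_sl2_action "\<lambda>p. - mult_t (del g (del g p)) + Polynomial.smult (2 * b - 2) (del g p)"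
    mult_t h
    unfolding h_def by (rule poly_sl2_action_T2)
  obtain m where n: "n = Suc (Suc m)" using g(2) by (metis add_2_eq_Suc le_Suc_ex)
  \<comment> \<open>The leading coefficient of g'.\<close>
  define l where "l = of_nat n * a n"
  have an: "a n = lead_coeff g" using g(1) g(3)[of "n - 1"] by (simp add: n)
  then have l: "l \<noteq> 0" using g(1,2) by (auto simp: l_def)
  \<comment> \<open>Here h - b + 1 = -t \<partial>, so \<open>P w\<close> is t times
    \<open>u\<close>: the last generator, the constant -1/l, goes to t g'/l. The condition on the
    matrix becomes that column \<open>j\<close> expands \<open>w j\<close> in the
    \<open>u i\<close>.\<close>
  define w where "w = (\<lambda>j. if j = n - 1 then [:- 1 / l:] else Polynomial.monom 1 (Suc j))"
  define u where "u = (\<lambda>j. if j = n - 1 then Polynomial.smult (1 / l) (pderiv g) else Polynomial.monom 1 j)"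
  have P_w: "poly_op h (P_entry (n - 1, 1, 0) b i) (w i) = mult_t (u i)" if "i < n" for i
  proof (cases "i = n - 1")
    case True
    have "poly_op h (P_entry (n - 1, 1, 0) b i) (w i) = - mult_t (del g (w i))"
      using True that by (simp add: h.poly_op_pCons h.poly_op_0 h.op_zero) (simp add: h_def weyl_simps)
    then show ?thesis using True
      by (simp add: w_def u_def del_def pderiv_pCons flip: mult_t_uminus)
  next
    case False
    then have "i < n - 1" using that by simp
    then show ?thesis
      by (simp add: w_def u_def one_pCons h.poly_op_const mult_t_monom)
  qed
  have K_w: "(\<Sum>i = 0..<n. Polynomial.smult (K2_mat n a $$ (i, j)) (u i)) = w j"
    if j: "j < n" for j
  proof (rule poly_eqI)
    fix k
    have "coeff (\<Sum>i = 0..<n. Polynomial.smult (K2_mat n a $$ (i, j)) (u i)) k =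
        (\<Sum>i = 0..<n. K2_mat n a $$ (i, j) * coeff (u i) k)"
      by (simp add: coeff_sum)
    also have "\<dots> = (\<Sum>i = 0..<Suc m. K2_mat n a $$ (i, j) * coeff (u i) k) +
        K2_mat n a $$ (Suc m, j) * coeff (u (Suc m)) k"
      unfolding n by simp
    also have "(\<Sum>i = 0..<Suc m. K2_mat n a $$ (i, j) * coeff (u i) k) =
        (\<Sum>i = 0..<Suc m. if i = k then K2_mat n a $$ (k, j) else 0)"
      by (intro sum.cong) (auto simp: u_def n)
    also have "(\<Sum>i = 0..<Suc m. if i = k then K2_mat n a $$ (k, j) else 0) =
        (if k < Suc m then K2_mat n a $$ (k, j) else 0)"
      by simp
    also have "coeff (u (Suc m)) k = of_nat (Suc k) * coeff g (Suc k) / l"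
      by (simp add: u_def n coeff_pderiv)
    also have "(if k < Suc m then K2_mat n a $$ (k, j) else 0) +
        K2_mat n a $$ (Suc m, j) * (of_nat (Suc k) * coeff g (Suc k) / l) = coeff (w j) k"
    proof -
      \<comment> \<open>Only column \<open>m\<close> is not a multiple of a single unit vector: it
        expresses t^(n-1) as the monic polynomial g'/l minus its lower terms.\<close>
      consider "j = Suc m" | "j = m" | "j < m" using j n by linarith
      then show ?thesis
      proof cases
        case 1
        then show ?thesis
          by (simp add: K2_mat_def w_def n l_def coeff_pCons split: nat.split)
      next
        case 2
        consider "k < Suc m" | "k = Suc m" | "Suc m < k" by linarith
        then show ?thesis
        proof cases
          case 1
          then show ?thesis
            using \<open>j = m\<close> g(3)[of k] by (simp add: K2_mat_def w_def n l_def del: of_nat_Suc)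
        next
          case 2
          then show ?thesis
            using \<open>j = m\<close> g(3)[of k] l by (simp add: K2_mat_def w_def n l_def del: of_nat_Suc)
        next
          case 3
          then show ?thesis
            using \<open>j = m\<close> g(1) by (simp add: K2_mat_def w_def n coeff_eq_0)
        qed
      next
        case 3
        then show ?thesis by (auto simp: K2_mat_def w_def n)
      qed
    qed
    finally show "coeff (\<Sum>i = 0..<n. Polynomial.smult (K2_mat n a $$ (i, j)) (u i)) k = coeff (w j) k" .
  qed
  show ?thesis
    unfolding T2_def h_def[symmetric]
  proof (rule isomorphic_M_alpha[where w = w])
    show "K2_mat n a \<in> GL TYPE(complex) n"
      using g(1,2) an by (intro K2_mat_GL) auto
    show "degree_raising_operator h n"
      using degree_raising_T2[of g "b - 1"] g(1,2) by (simp add: h_def)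
    show "w j \<noteq> 0" if "j < n" for j
      using l by (auto simp: w_def)
    have deg: "degree (w j) = (if j = n - 1 then 0 else Suc j)" for j
      by (simp add: w_def degree_monom_eq)
    show "bij_betw (\<lambda>j. degree (w j)) {0..<n} {0..<n}"
      unfolding deg using g(2)
      by (intro bij_betw_byWitness[where f' = "\<lambda>i. if i = 0 then n - 1 else i - 1"]) auto
    show "mult_t (w j) = (\<Sum>i = 0..<n. Polynomial.smult (K2_mat n a $$ (i, j))
        (poly_op h (P_entry (n - 1, 1, 0) b i) (w i)))" if "j < n" for j
    proof -
      have "mult_t (w j) = (\<Sum>i = 0..<n. Polynomial.smult (K2_mat n a $$ (i, j)) (mult_t (u i)))"
        unfolding K_w[OF that, symmetric] by (simp only: f.op_sum mult_t_smult)
      then show ?thesis by (rule trans) (rule sum.cong[OF refl], simp only: P_w atLeast0LessThan lessThan_iff)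
    qed
    show "p = 0" if "mult_t p = 0" for p
      using that by (simp add: mult_t_eq_0_iff)
    \<comment> \<open>Both sides are t \<partial> (-t \<partial> + 2b - 1).\<close>
    show "mult_t (- mult_t (del g (del g p)) + Polynomial.smult (2 * b - 2) (del g p)) = poly_op h (lam b) p" for p
      by (simp add: lam_def h.poly_op_pCons h.poly_op_0 h.op_zero)
        (simp add: h_def weyl_simps numeral_mult_poly algebra_simps)
  qed (use g in simp)
qed

theorem proposition6p7:
  fixes b :: complex and n :: nat and a :: "nat \<Rightarrow> complex" and g :: "complex poly"
  assumes "g = (\<Sum>i = 1..n. Polynomial.monom (a i) i)"
    and "n \<ge> 2"
    and "a n \<noteq> 0"
  shows "K1_mat n a \<in> GL TYPE(complex) n \<and>
    K2_mat n a \<in> GL TYPE(complex) n \<and>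
    sl2_isomorphic (T1 g b) (M_alpha b (1, n - 1, 0) (const_mat (K1_mat n a))) \<and>
    sl2_isomorphic (T2 g b) (M_alpha b (n - 1, 1, 0) (const_mat (K2_mat n a)))"
proof -
  have coeff_g: "coeff g k = (if k \<in> {1..n} then a k else 0)" for k
    using assms(1) by (simp add: coeff_sum)
  have "degree g = n"
    using assms(2,3) by (intro antisym degree_le le_degree) (auto simp: coeff_g)
  moreover have "coeff g (Suc i) = a (Suc i)" if "i < n" for i
    using that by (simp add: coeff_g)
  ultimately show ?thesis
    using assms(2,3) by (intro conjI K1_mat_GL K2_mat_GL T1_isomorphic T2_isomorphic) auto
qed
end
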